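(* Let $\alpha\in\mathrm{Comp}'_n$ and let $\beta$ be a composition of $n$, with $N\ge n$. The coefficient of $G_\beta(x_1,\ldots,x_N;t)$ in the expansion of the peak quasisymmetric function $K_\alpha$ in the basis $\{G_\gamma\}$ equals $k(\alpha,\beta)$ if $\mathrm{sub}(\alpha)\subseteq\mathrm{sub}(\beta)\cup(\mathrm{sub}(\beta)+1)$, and $0$ otherwise.
   Context: For a composition $\alpha$ of $n$, $\mathrm{sub}(\alpha)\subseteq[n-1]$ is its set of proper partial sums $\{\alpha_1,\alpha_1+\alpha_2,\ldots\}$. For $B\subseteq[n-1]$, $B+1=\{b+1:b\in B\}\setminus\{n\}$ and $B-1=\{b-1:b\in B\}\setminus\{0\}$; $\triangle$ is symmetric difference. $\mathrm{Comp}'_n$ is the set of compositions $\alpha$ of $n$ such that $\mathrm{sub}(\alpha)$ contains no two consecutive integers. $F_\beta(x_1,\ldots,x_N)=\sum x_{w_1}\cdots x_{w_n}$ over $1\le w_1\le\dots\le w_n\le N$ with $w_j<w_{j+1}$ for $j\in\mathrm{sub}(\beta)$; the peak quasisymmetric function is $K_\alpha=\sum_{\beta:\ \mathrm{sub}(\alpha)\subseteq\mathrm{sub}(\beta)\triangle(\mathrm{sub}(\beta)+1)}F_\beta$. With $\gamma\succeq\alpha$ iff $\mathrm{sub}(\alpha)\subseteq\mathrm{sub}(\gamma)$, and for such pairs $s(\alpha,\gamma)=\sum_j j(i_j-i_{j-1}-1)$ where $\alpha_j=\gamma_{i_{j-1}+1}+\dots+\gamma_{i_j}$, $0=i_0<\dots<i_k=\ell(\gamma)$,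 Hivert's quasisymmetric Hall–Littlewood polynomials are $G_\alpha=\sum_{\gamma\succeq\alpha}(-1)^{\ell(\gamma)-\ell(\alpha)}t^{s(\alpha,\gamma)}F_\gamma$. Write $\mathrm{sub}(\beta)=\{b_1<\dots<b_p\}$. For each $i$, $k(b_i)=1+t^i$ if $b_i\notin\mathrm{sub}(\alpha)\cup(\mathrm{sub}(\alpha)-1)$; $k(b_i)=t^{i-1}+t^i$ if $b_i\in\mathrm{sub}(\alpha)$ and $b_i-1=b_{i-1}$; and $k(b_i)=1$ otherwise. Then $k(\alpha,\beta)=\prod_{i=1}^p k(b_i)$. *)

theory Defs
  imports
    "HOL-Library.Poly_Mapping"
    "HOL-Library.FuncSet"
    "HOL-Computational_Algebra.Computational_Algebra"
begin

type_synonym coef = "rat poly fract"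

text \<open>Polynomials in \<open>x\<^sub>0, x\<^sub>1, \<dots>\<close> over the field \<open>\<rat>(t)\<close>: finitely supported functions
  on the monomials, a monomial being a finitely supported exponent vector, multiplied by
  convolution. Only \<open>x\<^sub>1, \<dots>, x\<^sub>N\<close> are used.\<close>

type_synonym xpoly = "(nat \<Rightarrow>\<^sub>0 nat) \<Rightarrow>\<^sub>0 coef"

definition tvar :: coef
  where "tvar = to_fract [:0, 1:]"

definition xvar :: "nat \<Rightarrow> xpoly"
  where "xvar i = Poly_Mapping.single (Poly_Mapping.single i 1) 1"

definition xconst :: "coef \<Rightarrow> xpoly"
  where "xconst c = Poly_Mapping.single 0 c"

definition Comp :: "nat \<Rightarrow> nat list set"
  where "Comp n = {\<alpha>. (\<forall>a\<in>set \<alpha>. 0 < a) \<and> sum_list \<alpha> = n}"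

definition sub :: "nat list \<Rightarrow> nat set"
  where "sub \<alpha> = {sum_list (take i \<alpha>) |i. 0 < i \<and> i < length \<alpha>}"

definition shift_up :: "nat \<Rightarrow> nat set \<Rightarrow> nat set"
  where "shift_up n B = {b + 1 |b. b \<in> B} - {n}"

definition shift_down :: "nat set \<Rightarrow> nat set"
  where "shift_down B = {b - 1 |b. b \<in> B} - {0}"

definition Comp' :: "nat \<Rightarrow> nat list set"
  where "Comp' n = {\<alpha> \<in> Comp n. \<forall>b. \<not> (b \<in> sub \<alpha> \<and> b + 1 \<in> sub \<alpha>)}"

definition fund_words :: "nat \<Rightarrow> nat \<Rightarrow> nat list \<Rightarrow> (nat \<Rightarrow> nat) set"
  where "fund_words n N \<beta> =
    {w \<in> {1..n} \<rightarrow>\<^sub>E {1..N}.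
       (\<forall>j\<in>{1..<n}. w j \<le> w (j + 1)) \<and> (\<forall>j\<in>sub \<beta>. w j < w (j + 1))}"

definition F_poly :: "nat \<Rightarrow> nat \<Rightarrow> nat list \<Rightarrow> xpoly"
  where "F_poly n N \<beta> = (\<Sum>w\<in>fund_words n N \<beta>. \<Prod>j=1..n. xvar (w j))"

definition K_poly :: "nat \<Rightarrow> nat \<Rightarrow> nat list \<Rightarrow> xpoly"
  where "K_poly n N \<alpha> =
    (\<Sum>\<beta>\<in>{\<beta> \<in> Comp n. sub \<alpha> \<subseteq> sym_diff (sub \<beta>) (shift_up n (sub \<beta>))}. F_poly n N \<beta>)"

definition refines :: "nat list \<Rightarrow> nat list \<Rightarrow> bool"
  where "refines \<gamma> \<alpha> \<longleftrightarrow> sub \<alpha> \<subseteq> sub \<gamma>"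

text \<open>For \<open>\<gamma>\<close> refining \<open>\<alpha>\<close>, \<open>brk \<alpha> \<gamma> j\<close> is the index \<open>i\<^sub>j\<close> for which the first \<open>i\<^sub>j\<close> parts of
  \<open>\<gamma>\<close> make up the first \<open>j\<close> parts of \<open>\<alpha>\<close>; it is unique because the parts are positive.\<close>

definition brk :: "nat list \<Rightarrow> nat list \<Rightarrow> nat \<Rightarrow> nat"
  where "brk \<alpha> \<gamma> j =
    (THE i. i \<le> length \<gamma> \<and> sum_list (take i \<gamma>) = sum_list (take j \<alpha>))"

definition s_exp :: "nat list \<Rightarrow> nat list \<Rightarrow> nat"
  where "s_exp \<alpha> \<gamma> = (\<Sum>j=1..length \<alpha>. j * (brk \<alpha> \<gamma> j - brk \<alpha> \<gamma> (j - 1) - 1))"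

definition G_poly :: "nat \<Rightarrow> nat \<Rightarrow> nat list \<Rightarrow> xpoly"
  where "G_poly n N \<alpha> =
    (\<Sum>\<gamma>\<in>{\<gamma> \<in> Comp n. refines \<gamma> \<alpha>}.
       xconst ((-1) ^ (length \<gamma> - length \<alpha>) * tvar ^ s_exp \<alpha> \<gamma>) * F_poly n N \<gamma>)"

text \<open>\<open>sub_nth \<beta> i\<close> is \<open>b\<^sub>i\<close>, for \<open>1 \<le> i \<le> p = card (sub \<beta>)\<close>.\<close>

definition sub_nth :: "nat list \<Rightarrow> nat \<Rightarrow> nat"
  where "sub_nth \<beta> i = sorted_list_of_set (sub \<beta>) ! (i - 1)"

text \<open>There is no \<open>b\<^sub>0\<close>: for \<open>i = 1\<close> the condition \<open>b\<^sub>i - 1 = b\<^bsub>i-1\<^esub>\<close> fails, even if \<open>b\<^sub>1 = 1\<close>.\<close>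

definition k_factor :: "nat list \<Rightarrow> nat list \<Rightarrow> nat \<Rightarrow> coef"
  where "k_factor \<alpha> \<beta> i =
    (if sub_nth \<beta> i \<notin> sub \<alpha> \<union> shift_down (sub \<alpha>) then 1 + tvar ^ i
     else if sub_nth \<beta> i \<in> sub \<alpha> \<and> 1 < i \<and> sub_nth \<beta> i - 1 = sub_nth \<beta> (i - 1)
       then tvar ^ (i - 1) + tvar ^ i
     else 1)"

definition k_coef :: "nat list \<Rightarrow> nat list \<Rightarrow> coef"
  where "k_coef \<alpha> \<beta> = (\<Prod>i=1..card (sub \<beta>). k_factor \<alpha> \<beta> i)"

text \<open>\<open>c\<close> is a family of coefficients expressing \<open>f\<close> as a linear combination of the
  quasisymmetric Hall--Littlewood polynomials indexed by the compositions of \<open>n\<close>.\<close>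

definition G_expansion :: "nat \<Rightarrow> nat \<Rightarrow> xpoly \<Rightarrow> (nat list \<Rightarrow> coef) \<Rightarrow> bool"
  where "G_expansion n N f c \<longleftrightarrow> f = (\<Sum>\<gamma>\<in>Comp n. xconst (c \<gamma>) * G_poly n N \<gamma>)"

end

theory Submission
  imports Defs
begin

text \<open>Identify a composition with its set of partial sums. Then
  \<open>G\<^sub>B = \<Sum>\<^bsub>C \<supseteq> B\<^esub> \<Prod>\<^bsub>c \<in> C - B\<^esub> (- t\<^bsup>1 + |{b \<in> B. b < c}|\<^esup>) F\<^sub>C\<close>, so comparing coefficients of \<open>F\<^sub>C\<close> reduces
  the expansion to an identity for a sum over all \<open>B \<subseteq> C\<close> of products of local factors, each
  depending only on the part of \<open>B\<close> up to its position. Hence the largest elements can be summed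
  out first: a position away from \<open>A\<close> contributes \<open>(1 + t\<^bsup>r+1\<^esup>) - t\<^bsup>r+1\<^esup> = 1\<close>, and a pair
  \<open>{a - 1, a}\<close> with \<open>a \<in> A\<close> contributes \<open>1\<close> if \<open>C\<close> contains exactly one of the two and \<open>0\<close>
  otherwise. Uniqueness holds because the matrix of \<open>G\<close> in terms of \<open>F\<close>, and that of the
  coefficients of \<open>F\<close> at suitable monomials, are unitriangular for inclusion.\<close>

section \<open>Compositions and their partial sums\<close>

lemma Comp_pos: "\<alpha> \<in> Comp n \<Longrightarrow> a \<in> set \<alpha> \<Longrightarrow> 0 < a"
  by (simp add: Comp_def)

lemma Comp_sum_list: "\<alpha> \<in> Comp n \<Longrightarrow> sum_list \<alpha> = n"
  by (simp add: Comp_def)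

lemma sum_list_take_less:
  fixes \<alpha> :: "nat list"
  assumes "\<forall>a\<in>set \<alpha>. 0 < a" "i < j" "j \<le> length \<alpha>"
  shows "sum_list (take i \<alpha>) < sum_list (take j \<alpha>)"
proof -
  have *: "sum_list (take k \<alpha>) < sum_list (take (Suc k) \<alpha>)" if "k < length \<alpha>" for k
    using assms(1) that by (simp add: take_Suc_conv_app_nth)
  show ?thesis
    using assms(2,3)
  proof (induction j)
    case (Suc j)
    then show ?case using *[of j] by (cases "i = j") auto
  qed simp
qed

lemma sum_list_take_less_iff:
  assumes "\<alpha> \<in> Comp n" "i \<le> length \<alpha>" "j \<le> length \<alpha>"
  shows "sum_list (take i \<alpha>) < sum_list (take j \<alpha>) \<longleftrightarrow> i < j"
  using sum_list_take_less[of \<alpha> i j] sum_list_take_less[of \<alpha> j i] assms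
  by (metis Comp_pos linorder_neqE_nat order_less_asym order_less_irrefl)

lemma sum_list_take_eq_iff:
  assumes "\<alpha> \<in> Comp n" "i \<le> length \<alpha>" "j \<le> length \<alpha>"
  shows "sum_list (take i \<alpha>) = sum_list (take j \<alpha>) \<longleftrightarrow> i = j"
  using sum_list_take_less_iff[OF assms] sum_list_take_less_iff[OF assms(1,3,2)]
  by (metis linorder_neqE_nat order_less_irrefl)

lemma sub_eq_image: "sub \<alpha> = (\<lambda>i. sum_list (take i \<alpha>)) ` {1..<length \<alpha>}"
  by (auto simp: sub_def)

lemma finite_sub [simp]: "finite (sub \<alpha>)"
  by (simp add: sub_eq_image)

lemma sub_subset: assumes "\<alpha> \<in> Comp n" shows "sub \<alpha> \<subseteq> {1..<n}"
proof
  fix x assume "x \<in> sub \<alpha>"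
  then obtain i where i: "x = sum_list (take i \<alpha>)" "0 < i" "i < length \<alpha>"
    by (auto simp: sub_def)
  then show "x \<in> {1..<n}"
    using sum_list_take_less_iff[OF assms, of 0 i]
      sum_list_take_less_iff[OF assms, of i "length \<alpha>"] Comp_sum_list[OF assms]
    by auto
qed

lemma card_sub: assumes "\<alpha> \<in> Comp n" shows "card (sub \<alpha>) = length \<alpha> - 1"
proof -
  have "inj_on (\<lambda>i. sum_list (take i \<alpha>)) {1..<length \<alpha>}"
    using sum_list_take_eq_iff[OF assms] by (auto simp: inj_on_def)
  then show ?thesis by (simp add: sub_eq_image card_image)
qed

lemma length_Comp: assumes "\<alpha> \<in> Comp n" "0 < n" shows "length \<alpha> = Suc (card (sub \<alpha>))"
  using card_sub[OF assms(1)] Comp_sum_list[OF assms(1)] assms(2) by (cases \<alpha>) auto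

lemma Comp_0 [simp]: "Comp 0 = {[]}"
proof -
  have "\<alpha> = []" if "\<alpha> \<in> Comp 0" for \<alpha>
    using that by (cases \<alpha>) (auto simp: Comp_def)
  then show ?thesis by (auto simp: Comp_def)
qed

lemma sub_Nil [simp]: "sub [] = {}"
  by (simp add: sub_def)

section \<open>Compositions of n as subsets of [n-1], by peeling off the last part\<close>

lemma sub_snoc:
  "sub (\<alpha> @ [x]) = (if \<alpha> = [] then {} else insert (sum_list \<alpha>) (sub \<alpha>))"
proof (cases "\<alpha> = []")
  case False
  then have "{1..<length (\<alpha> @ [x])} = insert (length \<alpha>) {1..<length \<alpha>}"
    by (auto simp: neq_Nil_conv)
  then show ?thesis using False by (auto simp: sub_eq_image)
qed (simp add: sub_def)

lemma snoc_in_Comp_iff: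
  "\<alpha> @ [x] \<in> Comp n \<longleftrightarrow> \<alpha> \<in> Comp (n - x) \<and> 0 < x \<and> x \<le> n"
  by (auto simp: Comp_def)

text \<open>Once the last part is peeled off, the sum of the remaining parts is the largest element
  of \<open>sub\<close>. Equal sets have equal maxima, hence equal last parts, and the induction
  hypothesis handles the rest.\<close>

lemma inj_on_sub: "inj_on sub (Comp n)"
proof -
  have "\<alpha> \<in> Comp n \<Longrightarrow> \<beta> \<in> Comp n \<Longrightarrow> sub \<alpha> = sub \<beta> \<Longrightarrow> \<alpha> = \<beta>" for \<alpha> \<beta> n
  proof (induction \<alpha> arbitrary: \<beta> n rule: rev_induct)
    case Nil
    then have "n = 0" by (simp add: Comp_def)
    then show ?case using Nil.prems by simp
  next
    case (snoc x \<alpha>)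
    have "0 < n" using snoc.prems(1) by (auto simp: Comp_def)
    then have "\<beta> \<noteq> []" using snoc.prems(2) by (auto simp: Comp_def)
    then obtain \<beta>' y where \<beta>: "\<beta> = \<beta>' @ [y]" by (metis rev_exhaust)
    have \<alpha>': "\<alpha> \<in> Comp (n - x)" "0 < x" "x \<le> n" and \<beta>': "\<beta>' \<in> Comp (n - y)" "0 < y" "y \<le> n"
      using snoc.prems \<beta> by (auto simp: snoc_in_Comp_iff)
    have sums: "sum_list \<alpha> = n - x" "sum_list \<beta>' = n - y"
      using \<alpha>' \<beta>' by (auto simp: Comp_def)
    show ?case
    proof (cases "\<alpha> = [] \<or> \<beta>' = []")
      case True
      then have "\<alpha> = []" "\<beta>' = []" using snoc.prems(3) \<beta> by (auto simp: sub_snoc split: if_splits)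
      then show ?thesis using \<alpha>' \<beta>' \<beta> by (auto simp: Comp_def)
    next
      case False
      then have eq: "insert (n - x) (sub \<alpha>) = insert (n - y) (sub \<beta>')"
        using snoc.prems(3) \<beta> sums by (simp add: sub_snoc)
      have lt: "\<And>z. z \<in> sub \<alpha> \<Longrightarrow> z < n - x" "\<And>z. z \<in> sub \<beta>' \<Longrightarrow> z < n - y"
        using sub_subset[OF \<alpha>'(1)] sub_subset[OF \<beta>'(1)] by auto
      have "n - x = n - y"
        using eq lt by (metis insert_iff order_less_asym)
      moreover from this eq lt have "sub \<alpha> = sub \<beta>'"
        by (metis insert_ident order_less_irrefl)
      ultimately show ?thesis
        using snoc.IH[of "n - x" \<beta>'] \<alpha>' \<beta>' \<beta> by auto
    qed
  qed
  then show ?thesis by (rule inj_onI)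
qed

lemma ex_Comp_sub: "B \<subseteq> {1..<n} \<Longrightarrow> \<exists>\<alpha>\<in>Comp n. sub \<alpha> = B"
proof (induction n arbitrary: B rule: less_induct)
  case (less n)
  show ?case
  proof (cases "B = {}")
    case True
    \<comment> \<open>Parts must be positive, so the composition with no proper partial sum is
      \<open>[]\<close>, not \<open>[0]\<close>, when \<open>n = 0\<close>.\<close>
    have "(if n = 0 then [] else [n]) \<in> Comp n" "sub (if n = 0 then [] else [n]) = B"
      using True by (auto simp: Comp_def sub_eq_image)
    then show ?thesis by blast
  next
    case False
    define m where "m = Max B"
    have fin: "finite B" using less.prems finite_subset by blast
    have m: "m \<in> B" "\<And>b. b \<in> B \<Longrightarrow> b \<le> m" using False fin by (auto simp: m_def)
    have mn: "0 < m" "m < n" using m less.prems by auto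
    have "B - {m} \<subseteq> {1..<m}"
      using less.prems m by (force simp: nat_less_le)
    from less.IH[OF mn(2) this] obtain \<alpha> where \<alpha>: "\<alpha> \<in> Comp m" "sub \<alpha> = B - {m}" by blast
    have "\<alpha> \<noteq> []" using \<alpha> mn by (auto simp: Comp_def)
    then have "\<alpha> @ [n - m] \<in> Comp n" "sub (\<alpha> @ [n - m]) = B"
      using \<alpha> mn m(1) by (auto simp: snoc_in_Comp_iff sub_snoc Comp_sum_list)
    then show ?thesis by blast
  qed
qed

text \<open>This turns sums over compositions into sums over subsets, where elements can be summed
  out one at a time.\<close>

lemma bij_betw_sub: "bij_betw sub (Comp n) (Pow {1..<n})"
  unfolding bij_betw_def using inj_on_sub ex_Comp_sub[of _ n] sub_subset[of _ n] by blast

lemma finite_Comp [simp]: "finite (Comp n)"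
  using bij_betw_finite[OF bij_betw_sub[of n]] by simp

section \<open>The transition coefficients as products over subsets\<close>

text \<open>The exponent at \<open>c\<close> is the 1-based index of the part of the coarser
  composition that has \<open>c\<close> strictly inside it.\<close>

definition gcoef :: "'a::comm_ring_1 \<Rightarrow> nat set \<Rightarrow> nat set \<Rightarrow> 'a"
  where "gcoef t B C = (\<Prod>c\<in>C - B. - (t ^ Suc (card {b\<in>B. b < c})))"

text \<open>If part j of \<alpha> splits into k parts of \<gamma>, it has k - 1 partial sums of
  \<gamma> in its interior. Each of them has j - 1 elements of \<open>sub \<alpha>\<close> below it,
  so it accounts for one summand j.\<close>

lemma s_exp_eq:
  assumes \<alpha>: "\<alpha> \<in> Comp n" and \<gamma>: "\<gamma> \<in> Comp n" and le: "sub \<alpha> \<subseteq> sub \<gamma>"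
  shows "s_exp \<alpha> \<gamma> = (\<Sum>c\<in>sub \<gamma> - sub \<alpha>. Suc (card {a\<in>sub \<alpha>. a < c}))"
proof -
  define P where "P = (\<lambda>i. sum_list (take i \<alpha>))"
  define Q where "Q = (\<lambda>i. sum_list (take i \<gamma>))"
  \<comment> \<open>\<open>T j\<close> holds the partial sums of \<gamma> strictly inside part j of
    \<alpha>.\<close>
  define T where "T = (\<lambda>j. {c\<in>sub \<gamma> - sub \<alpha>. P (j - 1) < c \<and> c < P j})"
  have Pless: "P i < P j \<longleftrightarrow> i < j" if "i \<le> length \<alpha>" "j \<le> length \<alpha>" for i j
    using sum_list_take_less_iff[OF \<alpha> that] by (simp add: P_def)
  have Qless: "Q i < Q j \<longleftrightarrow> i < j" if "i \<le> length \<gamma>" "j \<le> length \<gamma>" for i j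
    using sum_list_take_less_iff[OF \<gamma> that] by (simp add: Q_def)
  have Qeq: "Q i = Q j \<longleftrightarrow> i = j" if "i \<le> length \<gamma>" "j \<le> length \<gamma>" for i j
    using sum_list_take_eq_iff[OF \<gamma> that] by (simp add: Q_def)
  have subP: "sub \<alpha> = P ` {1..<length \<alpha>}" and subQ: "sub \<gamma> = Q ` {1..<length \<gamma>}"
    by (simp_all add: sub_eq_image P_def Q_def)
  have ends: "P 0 = 0" "Q 0 = 0" "P (length \<alpha>) = n" "Q (length \<gamma>) = n"
    using Comp_sum_list[OF \<alpha>] Comp_sum_list[OF \<gamma>] by (simp_all add: P_def Q_def)
  \<comment> \<open>Existence of the index comes from
    \<open>sub \<alpha> \<subseteq> sub \<gamma>\<close> and the common endpoints 0 and n,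
    uniqueness from the strict growth of \<open>Q\<close>; together they discharge the
    \<open>THE\<close> in \<open>brk\<close>.\<close>
  have brk: "brk \<alpha> \<gamma> j \<le> length \<gamma> \<and> Q (brk \<alpha> \<gamma> j) = P j" if j: "j \<le> length \<alpha>" for j
  proof -
    have "\<exists>i\<le>length \<gamma>. Q i = P j"
    proof -
      consider "j = 0" | "j = length \<alpha>" | "0 < j" "j < length \<alpha>" using j by linarith
      then show ?thesis
      proof cases
        case 3
        then have "P j \<in> sub \<gamma>" using le by (auto simp: subP)
        then obtain i where "i \<in> {1..<length \<gamma>}" "P j = Q i" unfolding subQ by blast
        then show ?thesis by (auto intro: exI[of _ i])
      qed (use ends in auto)
    qed
    then obtain i where i: "i \<le> length \<gamma>" "Q i = P j" by blast
    have "brk \<alpha> \<gamma> j = i"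
      unfolding brk_def
    proof (rule the_equality)
      show "i \<le> length \<gamma> \<and> sum_list (take i \<gamma>) = sum_list (take j \<alpha>)"
        using i by (simp add: P_def Q_def)
      show "k = i" if "k \<le> length \<gamma> \<and> sum_list (take k \<gamma>) = sum_list (take j \<alpha>)" for k
        using that i Qeq[of k i] by (simp add: P_def Q_def)
    qed
    then show ?thesis using i by simp
  qed
  have card_T: "card (T j) = brk \<alpha> \<gamma> j - brk \<alpha> \<gamma> (j - 1) - 1"
    and card_less: "c \<in> T j \<Longrightarrow> Suc (card {a\<in>sub \<alpha>. a < c}) = j"
    if j: "j \<in> {1..length \<alpha>}" for j c
  proof -
    have bj: "brk \<alpha> \<gamma> j \<le> length \<gamma>" "Q (brk \<alpha> \<gamma> j) = P j"
      "brk \<alpha> \<gamma> (j-1) \<le> length \<gamma>" "Q (brk \<alpha> \<gamma> (j-1)) = P (j-1)"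
      using brk[of j] brk[of "j-1"] j by auto
    have gap: "\<not> (P (j - 1) < P i \<and> P i < P j)" if "i \<le> length \<alpha>" for i
    proof -
      have "P (j - 1) < P i \<longleftrightarrow> j - 1 < i" "P i < P j \<longleftrightarrow> i < j"
        using j that by (auto intro!: Pless)
      then show ?thesis by linarith
    qed
    have "T j = Q ` {brk \<alpha> \<gamma> (j-1)<..<brk \<alpha> \<gamma> j}"
    proof (intro equalityI subsetI)
      fix c assume c: "c \<in> T j"
      then obtain i where "c = Q i" "1 \<le> i" "i < length \<gamma>" by (auto simp: T_def subQ)
      then show "c \<in> Q ` {brk \<alpha> \<gamma> (j-1)<..<brk \<alpha> \<gamma> j}"
        using c bj Qless[of i "brk \<alpha> \<gamma> j"] Qless[of "brk \<alpha> \<gamma> (j-1)" i] by (auto simp: T_def)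
    next
      fix c assume "c \<in> Q ` {brk \<alpha> \<gamma> (j-1)<..<brk \<alpha> \<gamma> j}"
      then obtain i where i: "c = Q i" "brk \<alpha> \<gamma> (j-1) < i" "i < brk \<alpha> \<gamma> j" by auto
      then have "P (j - 1) < c" "c < P j"
        using bj Qless[of i "brk \<alpha> \<gamma> j"] Qless[of "brk \<alpha> \<gamma> (j-1)" i] by auto
      moreover have "c \<in> sub \<gamma>" using i bj by (auto simp: subQ)
      moreover have "c \<notin> sub \<alpha>" using calculation(1,2) gap by (auto simp: subP)
      ultimately show "c \<in> T j" by (simp add: T_def)
    qed
    moreover have "inj_on Q {brk \<alpha> \<gamma> (j-1)<..<brk \<alpha> \<gamma> j}"
      using Qeq bj by (auto simp: inj_on_def)
    ultimately show "card (T j) = brk \<alpha> \<gamma> j - brk \<alpha> \<gamma> (j - 1) - 1"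
      by (simp add: card_image)
    assume c: "c \<in> T j"
    have "{a\<in>sub \<alpha>. a < c} = P ` {1..<j}"
    proof (intro equalityI subsetI)
      fix a assume "a \<in> {a\<in>sub \<alpha>. a < c}"
      then obtain i where i: "a = P i" "1 \<le> i" "i < length \<alpha>" "P i < c" by (auto simp: subP)
      moreover have "P i < P j" using i c by (auto simp: T_def)
      ultimately show "a \<in> P ` {1..<j}" using Pless[of i j] j by auto
    next
      fix a assume "a \<in> P ` {1..<j}"
      then obtain i where i: "a = P i" "1 \<le> i" "i < j" by auto
      moreover have "P i \<le> P (j - 1)" using Pless[of "j-1" i] i j by force
      ultimately show "a \<in> {a\<in>sub \<alpha>. a < c}" using c j by (auto simp: T_def subP)
    qed
    moreover have "inj_on P {1..<j}"
      using sum_list_take_eq_iff[OF \<alpha>] j by (auto simp: inj_on_def P_def)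
    ultimately show "Suc (card {a\<in>sub \<alpha>. a < c}) = j"
      using j by (simp add: card_image)
  qed
  have cover: "sub \<gamma> - sub \<alpha> = (\<Union>j\<in>{1..length \<alpha>}. T j)"
  proof (intro equalityI subsetI)
    fix c assume c: "c \<in> sub \<gamma> - sub \<alpha>"
    then have cn: "0 < c" "c < P (length \<alpha>)" using sub_subset[OF \<gamma>] ends by auto
    \<comment> \<open>The part containing \<open>c\<close> ends at the first partial sum of \<alpha>
      beyond \<open>c\<close>. Its left end differs from \<open>c\<close>: it is 0 if
      \<open>j = 1\<close>, and otherwise it lies in \<open>sub \<alpha>\<close>.\<close>
    define j where "j = (LEAST j. c < P j)"
    have j: "c < P j" "j \<le> length \<alpha>" "\<And>i. c < P i \<Longrightarrow> j \<le> i"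
      unfolding j_def using cn(2) by (auto intro: LeastI Least_le)
    have "j \<noteq> 0" using j(1) cn ends by (metis less_nat_zero_code)
    have "P (j - 1) \<le> c" using j(3)[of "j - 1"] \<open>j \<noteq> 0\<close> by force
    moreover have "P (j - 1) \<noteq> c"
    proof (cases "j = 1")
      case True
      then show ?thesis using cn ends by simp
    next
      case False
      then have "j - 1 \<in> {1..<length \<alpha>}" using \<open>j \<noteq> 0\<close> j(2) by auto
      then have "P (j - 1) \<in> sub \<alpha>" unfolding subP by blast
      then show ?thesis using c by auto
    qed
    ultimately show "c \<in> (\<Union>j\<in>{1..length \<alpha>}. T j)"
      using c j \<open>j \<noteq> 0\<close> by (auto simp: T_def intro!: bexI[of _ j])
  qed (auto simp: T_def)
  \<comment> \<open>By \<open>card_less\<close>, any element of \<open>T j\<close> determines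
    \<open>j\<close>.\<close>
  have disj: "T i \<inter> T j = {}" if "i \<in> {1..length \<alpha>}" "j \<in> {1..length \<alpha>}" "i \<noteq> j" for i j
    using card_less that by blast
  have "(\<Sum>c\<in>sub \<gamma> - sub \<alpha>. Suc (card {a\<in>sub \<alpha>. a < c})) =
      (\<Sum>j\<in>{1..length \<alpha>}. \<Sum>c\<in>T j. Suc (card {a\<in>sub \<alpha>. a < c}))"
    unfolding cover using disj by (intro sum.UNION_disjoint) (auto simp: T_def)
  also have "\<dots> = (\<Sum>j\<in>{1..length \<alpha>}. \<Sum>c\<in>T j. j)"
    using card_less by (intro sum.cong) auto
  also have "\<dots> = s_exp \<alpha> \<gamma>"
    unfolding s_exp_def using card_T by (intro sum.cong) (auto simp: mult.commute)
  finally show ?thesis by simp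
qed

lemma G_coefficient_eq:
  assumes \<alpha>: "\<alpha> \<in> Comp n" and \<gamma>: "\<gamma> \<in> Comp n" and le: "sub \<alpha> \<subseteq> sub \<gamma>"
  shows "(-1) ^ (length \<gamma> - length \<alpha>) * tvar ^ s_exp \<alpha> \<gamma> = gcoef tvar (sub \<alpha>) (sub \<gamma>)"
proof -
  have "length \<gamma> - length \<alpha> = card (sub \<gamma> - sub \<alpha>)"
  proof (cases "n = 0")
    case False
    then show ?thesis
      using length_Comp[OF \<alpha>] length_Comp[OF \<gamma>] le by (simp add: card_Diff_subset)
  qed (use assms in simp)
  then show ?thesis
    unfolding gcoef_def s_exp_eq[OF assms] power_sum
    by (simp add: prod.distrib[symmetric] flip: prod_constant)
qed

text \<open>The rank of \<open>b\<close> in \<open>B\<close> replaces the enumeration index, so the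
  factor sees no element of \<open>B\<close> above \<open>b\<close>. The test
  \<open>b - 1 \<in> B\<close> says that the preceding element is adjacent, provided
  \<open>b\<close> is positive; at \<open>b = 0\<close> truncated subtraction would make it
  \<open>0 \<in> B\<close>.\<close>

definition kfac :: "'a::comm_ring_1 \<Rightarrow> nat set \<Rightarrow> nat set \<Rightarrow> nat \<Rightarrow> 'a"
  where "kfac t A B b =
    (let i = card {x\<in>B. x \<le> b} in
     if b \<notin> A \<and> Suc b \<notin> A then 1 + t ^ i
     else if b \<in> A \<and> b - 1 \<in> B then t ^ (i - 1) + t ^ i else 1)"

lemma k_coef_eq:
  assumes "0 \<notin> sub \<beta>"
  shows "k_coef \<alpha> \<beta> = (\<Prod>b\<in>sub \<beta>. kfac tvar (sub \<alpha>) (sub \<beta>) b)"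
proof -
  define B where "B = sub \<beta>"
  define L where "L = sorted_list_of_set B"
  have L: "length L = card B" "set L = B" "distinct L"
    by (simp_all add: L_def B_def)
  have less: "L ! i < L ! j \<longleftrightarrow> i < j" if "i < card B" "j < card B" for i j
    using sorted_wrt_nth_less[of "(<)" L] strict_sorted_list_of_set[of B] that L(1)
    by (metis L_def linorder_neqE_nat order_less_asym order_less_irrefl)
  have nth: "\<exists>j<card B. b = L ! j" if "b \<in> B" for b
    using that L by (metis in_set_conv_nth)
  have mem: "L ! j \<in> B" if "j < card B" for j
    using that L by (metis nth_mem)
  have bij: "bij_betw (\<lambda>i. L ! (i - 1)) {1..card B} B"
  proof -
    have "bij_betw (\<lambda>i. i - 1) {1..card B} {..<card B}"
      by (rule bij_betw_byWitness[where f' = Suc]) auto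
    moreover have "bij_betw (\<lambda>i. L ! i) {..<card B} B"
      using bij_betw_nth[OF L(3)] L by auto
    ultimately show ?thesis
      using bij_betw_trans[of "\<lambda>i. i - 1" _ _ "(!) L"] by (simp add: o_def)
  qed
  have "k_factor \<alpha> \<beta> i = kfac tvar (sub \<alpha>) B (L ! (i - 1))" if i: "i \<in> {1..card B}" for i
  proof -
    let ?b = "L ! (i - 1)"
    have b: "?b \<in> B" using i mem by auto
    then have b0: "0 < ?b" using assms by (cases "?b") (auto simp: B_def)
    have "{x\<in>B. x \<le> ?b} = (!) L ` {..<i}"
    proof (intro equalityI subsetI)
      fix x assume x: "x \<in> {x\<in>B. x \<le> ?b}"
      then obtain j where j: "j < card B" "x = L ! j" using nth by auto
      then have "\<not> i - 1 < j" using x less[of "i - 1" j] i by auto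
      then show "x \<in> (!) L ` {..<i}" using j i by auto
    next
      fix x assume "x \<in> (!) L ` {..<i}"
      then obtain j where j: "j < i" "x = L ! j" by auto
      then have "\<not> L ! (i - 1) < L ! j" using less[of "i - 1" j] i by auto
      then show "x \<in> {x\<in>B. x \<le> ?b}" using j mem[of j] i by auto
    qed
    moreover have "inj_on ((!) L) {..<i}"
      using L i by (auto simp: inj_on_def nth_eq_iff_index_eq)
    ultimately have card: "card {x\<in>B. x \<le> ?b} = i" by (simp add: card_image)
    \<comment> \<open>Nothing fits strictly between \<open>?b - 1\<close> and \<open>?b\<close>, so
      if \<open>?b - 1\<close> is in \<open>B\<close> it must be the entry just before
      \<open>?b\<close> in the sorted list.\<close>
    have pred: "1 < i \<and> ?b - 1 = L ! (i - 1 - 1) \<longleftrightarrow> ?b - 1 \<in> B"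
    proof
      assume "1 < i \<and> ?b - 1 = L ! (i - 1 - 1)"
      then show "?b - 1 \<in> B" using mem[of "i - 1 - 1"] i by auto
    next
      assume "?b - 1 \<in> B"
      then obtain j where j: "j < card B" "?b - 1 = L ! j" using nth by blast
      then have "L ! j < ?b" using b0 by linarith
      then have ji: "j < i - 1" using less[of j "i - 1"] i j by auto
      have "\<not> j < i - 1 - 1"
      proof
        assume "j < i - 1 - 1"
        then have "L ! j < L ! (i - 1 - 1)" "L ! (i - 1 - 1) < ?b"
          using less[of j "i-1-1"] less[of "i-1-1" "i-1"] i by auto
        then show False using j(2) by linarith
      qed
      then have "j = i - 1 - 1" using ji by linarith
      then show "1 < i \<and> ?b - 1 = L ! (i - 1 - 1)" using j ji by auto
    qed
    have down: "?b \<in> shift_down (sub \<alpha>) \<longleftrightarrow> Suc ?b \<in> sub \<alpha>"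
      using b0 by (force simp: shift_down_def)
    show ?thesis
      unfolding k_factor_def kfac_def sub_nth_def L_def[symmetric] B_def[symmetric] card Let_def
      using pred down by auto
  qed
  then have "k_coef \<alpha> \<beta> = (\<Prod>i\<in>{1..card B}. kfac tvar (sub \<alpha>) B (L ! (i - 1)))"
    unfolding k_coef_def B_def[symmetric] by (intro prod.cong) auto
  also have "\<dots> = (\<Prod>b\<in>B. kfac tvar (sub \<alpha>) B b)"
    by (rule prod.reindex_bij_betw[OF bij])
  finally show ?thesis by (simp add: B_def)
qed

section \<open>The subset identity\<close>

text \<open>Merges the two products, of \<open>kfac\<close> over \<open>B\<close> and of the factors
  of \<open>gcoef\<close> over \<open>C - B\<close>, into one product over \<open>C\<close>, so that
  positions of \<open>C\<close> can be split off.\<close>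

definition wfac :: "'a::comm_ring_1 \<Rightarrow> nat set \<Rightarrow> nat set \<Rightarrow> nat \<Rightarrow> 'a"
  where "wfac t A B c =
    (if c \<in> B then kfac t A B c else - (t ^ Suc (card {b\<in>B. b < c})))"

definition weight :: "'a::comm_ring_1 \<Rightarrow> nat set \<Rightarrow> nat set \<Rightarrow> nat set \<Rightarrow> 'a"
  where "weight t A B C =
    (if A \<subseteq> B \<union> Suc ` B then \<Prod>c\<in>C. wfac t A B c else 0)"

lemma weight_eq:
  assumes "finite C" "B \<subseteq> C"
  shows "weight t A B C =
    (if A \<subseteq> B \<union> Suc ` B then (\<Prod>b\<in>B. kfac t A B b) * gcoef t B C else 0)"
proof -
  have "(\<Prod>c\<in>C. wfac t A B c) = (\<Prod>c\<in>C - B. wfac t A B c) * (\<Prod>c\<in>B. wfac t A B c)"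
    using assms by (intro prod.subset_diff)
  then show ?thesis by (simp add: weight_def gcoef_def wfac_def mult.commute)
qed

text \<open>Locality: the factor at \<open>c\<close> sees \<open>B\<close> only up to
  \<open>c\<close> and \<open>A\<close> only at \<open>c\<close> and \<open>c + 1\<close>. This is
  what allows the top positions to be summed out first.\<close>

lemma wfac_cong:
  assumes "B \<inter> {..c} = B' \<inter> {..c}" "A \<inter> {c, Suc c} = A' \<inter> {c, Suc c}"
  shows "wfac t A B c = wfac t A' B' c"
proof -
  have "{x\<in>B. x \<le> c} = {x\<in>B'. x \<le> c}" "{x\<in>B. x < c} = {x\<in>B'. x < c}"
    "c \<in> B \<longleftrightarrow> c \<in> B'" "c - 1 \<in> B \<longleftrightarrow> c - 1 \<in> B'" "c \<in> A \<longleftrightarrow> c \<in> A'" "Suc c \<in> A \<longleftrightarrow> Suc c \<in> A'"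
    using assms by (auto simp: set_eq_iff)
  then show ?thesis by (simp add: wfac_def kfac_def Let_def)
qed

lemma subset_cong: "(\<And>a. a \<in> A \<Longrightarrow> a \<in> X \<longleftrightarrow> a \<in> Y) \<Longrightarrow> A \<subseteq> X \<longleftrightarrow> A \<subseteq> Y"
  by (metis subset_iff)

lemma prod_wfac_cong:
  assumes "C \<subseteq> {..<m}" "B \<inter> {..<m} = B' \<inter> {..<m}" "A \<inter> {..m} = A' \<inter> {..m}"
  shows "(\<Prod>c\<in>C. wfac t A B c) = (\<Prod>c\<in>C. wfac t A' B' c)"
proof (intro prod.cong refl wfac_cong)
  fix c assume "c \<in> C"
  then have "{..c} \<subseteq> {..<m}" "{c, Suc c} \<subseteq> {..m}" using assms(1) by auto
  then show "B \<inter> {..c} = B' \<inter> {..c}" "A \<inter> {c, Suc c} = A' \<inter> {c, Suc c}"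
    using assms(2,3) by blast+
qed

lemma sum_Pow_insert:
  assumes "finite C" "m \<notin> C"
  shows "(\<Sum>B\<in>Pow (insert m C). f B) = (\<Sum>B\<in>Pow C. f B + f (insert m B))"
proof -
  have "inj_on (insert m) (Pow C)" using assms(2) by (auto simp: inj_on_def)
  moreover have "Pow C \<inter> insert m ` Pow C = {}" using assms(2) by auto
  ultimately show ?thesis
    using assms(1) by (simp add: Pow_insert sum.union_disjoint sum.reindex sum.distrib)
qed

text \<open>With r = |B|, omitting \<open>m\<close> gives the factor \<open>-t^(r+1)\<close> and
  including it gives \<open>1 + t^(r+1)\<close>, since neither \<open>m\<close> nor
  \<open>m + 1\<close> is in \<open>A\<close>. For the same reason \<open>m\<close> does not help to
  cover \<open>A\<close>, and the lower factors do not see \<open>m\<close>.\<close>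

lemma sum_weight_step_free:
  assumes C: "C \<subseteq> {..<m}" and A: "A \<subseteq> {..<m}"
  shows "(\<Sum>B\<in>Pow (insert m C). weight t A B (insert m C)) = (\<Sum>B\<in>Pow C. weight t A B C)"
proof -
  have fin: "finite C" and mC: "m \<notin> C" using C finite_subset by auto
  have "weight t A B (insert m C) + weight t A (insert m B) (insert m C) = weight t A B C"
    if B: "B \<subseteq> C" for B
  proof -
    have finB: "finite B" using B fin finite_subset by blast
    have mB: "m \<notin> B" "\<forall>b\<in>B. b < m" using B C by auto
    have ok: "A \<subseteq> insert m B \<union> Suc ` insert m B \<longleftrightarrow> A \<subseteq> B \<union> Suc ` B"
    proof (rule subset_cong)
      show "a \<in> insert m B \<union> Suc ` insert m B \<longleftrightarrow> a \<in> B \<union> Suc ` B" if "a \<in> A" for a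
        using that A by auto
    qed
    have pr: "(\<Prod>c\<in>C. wfac t A (insert m B) c) = (\<Prod>c\<in>C. wfac t A B c)"
      using C by (intro prod_wfac_cong[of _ m]) auto
    have "{b\<in>B. b < m} = B" "{x\<in>insert m B. x \<le> m} = insert m B" using mB by auto
    then have "wfac t A B m + wfac t A (insert m B) m = 1"
      using mB A finB by (auto simp: wfac_def kfac_def)
    then show ?thesis
      using fin mC unfolding weight_def ok by (simp add: pr distrib_right[symmetric])
  qed
  then show ?thesis using fin mC by (auto simp: sum_Pow_insert intro!: sum.cong)
qed

text \<open>Writing \<open>r = |B|\<close> for \<open>B \<subseteq> C\<close>, in the case \<open>F = {m, Suc m}\<close> the three ways to extend \<open>B\<close>
  contribute \<open>-t\<^bsup>r+2\<^esup>\<close>, \<open>-t\<^bsup>r+1\<^esup>\<close> and \<open>t\<^bsup>r+1\<^esup> + t\<^bsup>r+2\<^esup>\<close>, which cancel.\<close>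

lemma sum_weight_step_member:
  assumes C: "C \<subseteq> {..<m}" and A: "A \<subseteq> {..<m}" and F: "F \<subseteq> {m, Suc m}"
  shows "(\<Sum>B\<in>Pow (F \<union> C). weight t (insert (Suc m) A) B (F \<union> C)) =
    (if (m \<in> F) \<noteq> (Suc m \<in> F) then \<Sum>B\<in>Pow C. weight t A B C else 0)"
proof -
  define A' where "A' = insert (Suc m) A"
  have fin: "finite C" using C finite_subset by blast
  have mC: "m \<notin> C" "Suc m \<notin> C" using C by auto
  \<comment> \<open>\<open>E\<close> is the part of the chosen subset within
    \<open>{m, Suc m}\<close>. The factors on \<open>C\<close> do not see it, and it alone can cover
    the new element \<open>Suc m\<close>, so an empty \<open>E\<close> gives 0.\<close>
  have w: "weight t A' (E \<union> B) (F \<union> C) =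
      weight t A B C * (if E = {} then 0 else \<Prod>c\<in>F. wfac t A' (E \<union> B) c)"
    if B: "B \<subseteq> C" and E: "E \<subseteq> {m, Suc m}" for B E
  proof -
    have "(\<Prod>c\<in>C. wfac t A' (E \<union> B) c) = (\<Prod>c\<in>C. wfac t A B c)"
      using C A E unfolding A'_def by (intro prod_wfac_cong[of _ m]) auto
    moreover have "(\<Prod>c\<in>F \<union> C. wfac t A' (E \<union> B) c) =
        (\<Prod>c\<in>F. wfac t A' (E \<union> B) c) * (\<Prod>c\<in>C. wfac t A' (E \<union> B) c)"
      using F mC fin by (intro prod.union_disjoint) (auto intro: finite_subset)
    moreover have "A' \<subseteq> (E \<union> B) \<union> Suc ` (E \<union> B) \<longleftrightarrow> A \<subseteq> B \<union> Suc ` B \<and> E \<noteq> {}"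
    proof -
      have "Suc m \<in> (E \<union> B) \<union> Suc ` (E \<union> B) \<longleftrightarrow> E \<noteq> {}"
        using E B C by auto
      moreover have "A \<subseteq> (E \<union> B) \<union> Suc ` (E \<union> B) \<longleftrightarrow> A \<subseteq> B \<union> Suc ` B"
      proof -
        have "a \<in> (E \<union> B) \<union> Suc ` (E \<union> B) \<longleftrightarrow> a \<in> B \<union> Suc ` B" if "a \<in> A" for a
        proof -
          have "a \<noteq> m" "a \<noteq> Suc m" "a \<noteq> Suc (Suc m)" using that A by auto
          then show ?thesis using E by auto
        qed
        then show ?thesis by (rule subset_cong)
      qed
      ultimately show ?thesis by (auto simp: A'_def)
    qed
    ultimately show ?thesis by (simp add: weight_def mult.commute)
  qed
  have fB: "finite B" "m \<notin> B" "Suc m \<notin> B" "{b\<in>B. b < m} = B" "{b\<in>B. b < Suc m} = B"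
    "{b\<in>B. b \<le> m} = B" "{b\<in>B. b \<le> Suc m} = B" if "B \<subseteq> C" for B
    using that C fin finite_subset by (auto simp: less_Suc_eq)
  have Am: "m \<notin> A'" "Suc m \<in> A'" using A by (auto simp: A'_def)
  consider "F = {}" | "F = {m}" | "F = {Suc m}" | "F = {m, Suc m}" using F by blast
  then have "(\<Sum>B\<in>Pow (F \<union> C). weight t A' B (F \<union> C)) =
    (if (m \<in> F) \<noteq> (Suc m \<in> F) then \<Sum>B\<in>Pow C. weight t A B C else 0)"
  proof cases
    case 1
    then show ?thesis using w[of _ "{}"] by simp
  next
    case 2
    \<comment> \<open>Here and in the next case, omitting the only available position leaves
      \<open>Suc m\<close> uncovered. Taking it gives the factor 1: \<open>m\<close> is outside
      \<open>A'\<close> but just below an element of it, while \<open>Suc m\<close> has its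
      predecessor \<open>m\<close> missing from the subset.\<close>
    have "weight t A' B (F \<union> C) + weight t A' (insert m B) (F \<union> C) = weight t A B C"
      if "B \<subseteq> C" for B
      using w[OF that, of "{}"] w[OF that, of "{m}"] 2 Am fB[OF that]
      by (simp add: wfac_def kfac_def)
    then show ?thesis using 2 fin mC by (simp add: sum_Pow_insert)
  next
    case 3
    have "weight t A' B (F \<union> C) + weight t A' (insert (Suc m) B) (F \<union> C) = weight t A B C"
      if "B \<subseteq> C" for B
      using w[OF that, of "{}"] w[OF that, of "{Suc m}"] 3 Am fB[OF that]
      by (simp add: wfac_def kfac_def)
    then show ?thesis using 3 fin mC by (simp add: sum_Pow_insert)
  next
    case 4
    have *: "weight t A' B (F \<union> C) + weight t A' (insert m B) (F \<union> C)
        + (weight t A' (insert (Suc m) B) (F \<union> C) + weight t A' (insert m (insert (Suc m) B)) (F \<union> C)) = 0"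
      if B: "B \<subseteq> C" for B
    proof -
      note f = fB[OF B]
      have lt: "b < m" if "b \<in> B" for b using that B C by auto
      have "{b\<in>insert (Suc m) B. b < m} = B" "{b\<in>insert (Suc m) B. b \<le> Suc m} = insert (Suc m) B"
        "{b\<in>insert m B. b \<le> m} = insert m B" "{b\<in>insert m B. b < Suc m} = insert m B"
        "{b\<in>insert m (insert (Suc m) B). b \<le> m} = insert m B"
        "{b\<in>insert m (insert (Suc m) B). b \<le> Suc m} = insert m (insert (Suc m) B)"
        using lt by (auto intro: less_imp_le less_SucI le_SucI)
      \<comment> \<open>\<open>Suc m\<close> has the two-term factor only if \<open>m\<close> is
        chosen too; chosen alone it has factor 1, and the omitted \<open>m\<close> supplies the
        power of \<open>t\<close>.\<close>
      then have
        "wfac t A' (insert (Suc m) B) m = - (t ^ Suc (card B))"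
        "wfac t A' (insert (Suc m) B) (Suc m) = 1"
        "wfac t A' (insert m B) m = 1"
        "wfac t A' (insert m B) (Suc m) = - (t ^ Suc (Suc (card B)))"
        "wfac t A' (insert m (insert (Suc m) B)) m = 1"
        "wfac t A' (insert m (insert (Suc m) B)) (Suc m) = t ^ Suc (card B) + t ^ Suc (Suc (card B))"
        using f Am unfolding wfac_def kfac_def Let_def by (simp_all del: power_Suc)
      then show ?thesis
        using w[OF B, of "{}"] w[OF B, of "{Suc m}"] w[OF B, of "{m}"] w[OF B, of "{m, Suc m}"] 4
        by (simp add: algebra_simps)
    qed
    have "F \<union> C = insert m (insert (Suc m) C)" using 4 by auto
    then have "(\<Sum>B\<in>Pow (F \<union> C). weight t A' B (F \<union> C)) =
        (\<Sum>B\<in>Pow (insert m (insert (Suc m) C)). weight t A' B (F \<union> C))" by simp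
    also have "\<dots> = 0" using fin mC * by (simp add: sum_Pow_insert)
    finally show ?thesis using 4 by simp
  qed
  then show ?thesis by (simp add: A'_def)
qed

text \<open>Strong induction, because the bound drops by one or two. If the top position is not in
  \<open>A\<close> it is summed out alone. If it is in \<open>A\<close>, sparseness keeps its
  predecessor out of \<open>A\<close>, and the two positions are summed out as a pair.\<close>

lemma sum_weight:
  assumes "A \<subseteq> {1..<m}" "C \<subseteq> {1..<m}" "\<And>a. a \<in> A \<Longrightarrow> Suc a \<notin> A"
  shows "(\<Sum>B\<in>Pow C. weight t A B C) = (if A \<subseteq> sym_diff C (Suc ` C) then 1 else 0)"
  using assms
proof (induction m arbitrary: A C rule: less_induct)
  case (less m)
  consider "A = {}" "C = {}" | k where "m = Suc k" "k \<notin> A" | k where "m = Suc k" "k \<in> A"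
    using less.prems by (cases m) auto
  then show ?case
  proof cases
    case 1
    then show ?thesis by (simp add: weight_def)
  next
    case 2
    have A: "A \<subseteq> {1..<k}" using less.prems(1) 2 by (force simp: less_Suc_eq)
    have C: "C - {k} \<subseteq> {1..<k}" using less.prems(2) 2 by (force simp: less_Suc_eq)
    have "(\<Sum>B\<in>Pow C. weight t A B C) = (\<Sum>B\<in>Pow (C - {k}). weight t A B (C - {k}))"
    proof (cases "k \<in> C")
      case True
      then have "C = insert k (C - {k})" by auto
      moreover have "C - {k} \<subseteq> {..<k}" "A \<subseteq> {..<k}" using A C by auto
      ultimately show ?thesis using sum_weight_step_free by metis
    qed simp
    also have "\<dots> = (if A \<subseteq> sym_diff (C - {k}) (Suc ` (C - {k})) then 1 else 0)"
      using less.IH[OF _ A C] less.prems(3) 2 by simp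
    also have "A \<subseteq> sym_diff (C - {k}) (Suc ` (C - {k})) \<longleftrightarrow> A \<subseteq> sym_diff C (Suc ` C)"
    proof (rule subset_cong)
      show "a \<in> sym_diff (C - {k}) (Suc ` (C - {k})) \<longleftrightarrow> a \<in> sym_diff C (Suc ` C)" if "a \<in> A" for a
        using that A by auto
    qed
    finally show ?thesis .
  next
    case 3
    then obtain j where k: "k = Suc j" using less.prems(1) by (cases k) auto
    define A0 where "A0 = A - {Suc j}"
    define C0 where "C0 = C - {j, Suc j}"
    define F where "F = C \<inter> {j, Suc j}"
    have jA: "j \<notin> A" using less.prems(3)[of j] 3 k by blast
    have sets: "A = insert (Suc j) A0" "C = F \<union> C0"
      using 3(2) k unfolding A0_def C0_def F_def by blast+
    have m: "m = Suc (Suc j)" using 3 k by simp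
    have A0: "A0 \<subseteq> {1..<j}"
      using less.prems(1) jA unfolding A0_def m by (auto simp: less_Suc_eq)
    have C0: "C0 \<subseteq> {1..<j}"
      using less.prems(2) unfolding C0_def m by (auto simp: less_Suc_eq)
    have "C0 \<subseteq> {..<j}" "A0 \<subseteq> {..<j}" "F \<subseteq> {j, Suc j}" using A0 C0 by (auto simp: F_def)
    then have "(\<Sum>B\<in>Pow C. weight t A B C) =
        (if (j \<in> F) \<noteq> (Suc j \<in> F) then \<Sum>B\<in>Pow C0. weight t A0 B C0 else 0)"
      unfolding sets by (rule sum_weight_step_member)
    also have "(\<Sum>B\<in>Pow C0. weight t A0 B C0) = (if A0 \<subseteq> sym_diff C0 (Suc ` C0) then 1 else 0)"
      using less.IH[OF _ A0 C0] less.prems(3) 3 k by (simp add: A0_def)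
    also have "A0 \<subseteq> sym_diff C0 (Suc ` C0) \<longleftrightarrow> A0 \<subseteq> sym_diff C (Suc ` C)"
    proof -
      have "a \<in> sym_diff C0 (Suc ` C0) \<longleftrightarrow> a \<in> sym_diff C (Suc ` C)" if "a \<in> A0" for a
        using that A0 by (auto simp: C0_def)
      then show ?thesis by blast
    qed
    \<comment> \<open>The condition left by the pair is exactly the membership condition for the
      removed element \<open>Suc j\<close> of \<open>A\<close>.\<close>
    also have "(j \<in> F) \<noteq> (Suc j \<in> F) \<longleftrightarrow> Suc j \<in> sym_diff C (Suc ` C)"
      by (auto simp: F_def)
    finally show ?thesis by (simp add: sets(1))
  qed
qed

section \<open>Coefficients of fundamental quasisymmetric polynomials\<close>

lemma lookup_xconst_mult: "Poly_Mapping.lookup (xconst c * p) m = c * Poly_Mapping.lookup p m"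
  unfolding xconst_def mult_map_scale_conv_mult[symmetric]
  by (simp add: Poly_Mapping.map.rep_eq when_def)

lemma xconst_mult: "xconst (a * b) = xconst a * xconst b"
  by (simp add: xconst_def mult_single)

lemma xconst_sum: "xconst (sum f A) = (\<Sum>x\<in>A. xconst (f x))"
  by (induction A rule: infinite_finite_induct) (simp_all add: xconst_def single_add)

lemma xconst_0 [simp]: "xconst 0 = 0" and xconst_1 [simp]: "xconst 1 = 1"
  by (simp_all add: xconst_def)

definition xmon :: "nat \<Rightarrow> (nat \<Rightarrow> nat) \<Rightarrow> (nat \<Rightarrow>\<^sub>0 nat)"
  where "xmon n w = (\<Sum>j=1..n. Poly_Mapping.single (w j) 1)"

lemma prod_xvar: "(\<Prod>j=1..n. xvar (w j)) = Poly_Mapping.single (xmon n w) 1"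
proof -
  have "(\<Prod>j\<in>S. xvar (w j)) =
      Poly_Mapping.single (\<Sum>j\<in>S. Poly_Mapping.single (w j) 1) 1" if "finite S" for S
    using that by (induction S) (simp_all add: xvar_def mult_single)
  then show ?thesis by (simp add: xmon_def)
qed

text \<open>A monomial records the multiset of letters of a word, and a weakly increasing word is
  the sorted listing of that multiset.\<close>

lemma xmon_eq_imp_eq:
  assumes "xmon n v = xmon n w" "mono_on {1..n} v" "mono_on {1..n} w" "j \<in> {1..n}"
  shows "v j = w j"
proof -
  have count: "Poly_Mapping.lookup (xmon n u) i = count (mset (map u [1..<Suc n])) i" for u i
  proof -
    have "Poly_Mapping.lookup (xmon n u) i = (\<Sum>j=1..n. if u j = i then 1 else 0)"
      by (simp add: xmon_def lookup_sum lookup_single when_def del: One_nat_def)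
    also have "\<dots> = count (mset (map u [1..<Suc n])) i"
      by (induction n) (auto simp del: upt_Suc simp: upt_Suc_append)
    finally show ?thesis .
  qed
  have "mset (map v [1..<Suc n]) = mset (map w [1..<Suc n])"
    using assms(1) count by (metis multiset_eqI)
  moreover have "sorted (map u [1..<Suc n])" if "mono_on {1..n} u" for u :: "nat \<Rightarrow> nat"
    using that by (auto simp: sorted_iff_nth_mono mono_on_def simp del: upt_Suc)
  ultimately have "map v [1..<Suc n] = map w [1..<Suc n]"
    using assms(2,3) by (metis properties_for_sort)
  then show ?thesis using assms(4) by (auto simp del: upt_Suc)
qed

text \<open>The word that starts at 1 and rises by one exactly after the positions in
  \<open>C\<close>; its monomial serves as a test monomial.\<close>

definition canon_word :: "nat set \<Rightarrow> nat \<Rightarrow> nat"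
  where "canon_word C j = Suc (card (C \<inter> {1..<j}))"

text \<open>Admissible words are weakly increasing, so at most the canonical word yields this
  monomial, and it is admissible iff it rises at all of \<open>sub \<gamma>\<close>. Its letters are
  at most n, hence available when \<open>n \<le> N\<close>.\<close>

lemma lookup_F_poly:
  assumes \<gamma>: "\<gamma> \<in> Comp n" and C: "C \<subseteq> {1..<n}" and N: "n \<le> N"
  shows "Poly_Mapping.lookup (F_poly n N \<gamma>) (xmon n (canon_word C)) = (if sub \<gamma> \<subseteq> C then 1 else 0)"
proof -
  \<comment> \<open>\<open>fund_words\<close> consists of extensional functions, hence the
    restriction.\<close>
  let ?u = "restrict (canon_word C) {1..n}"
  have fin: "finite C" using C finite_subset by blast
  have mono: "mono_on {1..n} w" if w: "w \<in> fund_words n N \<gamma>" for w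
  proof -
    have *: "i \<le> j \<Longrightarrow> 1 \<le> i \<Longrightarrow> j \<le> n \<Longrightarrow> w i \<le> w j" for i j
    proof (induction j rule: dec_induct)
      case (step j)
      then have "w i \<le> w j" "w j \<le> w (j + 1)" using w by (auto simp: fund_words_def)
      then show ?case by simp
    qed simp
    then show ?thesis by (auto simp: mono_on_def)
  qed
  have canon_mono: "mono_on {1..n} (canon_word C)"
    by (auto simp: mono_on_def canon_word_def intro!: card_mono)
  have canon_Suc: "canon_word C (Suc j) = (if j \<in> C then Suc (canon_word C j) else canon_word C j)"
    if "1 \<le> j" for j
  proof -
    have "C \<inter> {1..<Suc j} = (if j \<in> C then insert j (C \<inter> {1..<j}) else C \<inter> {1..<j})"
      using that by (auto simp: less_Suc_eq)
    then show ?thesis by (simp add: canon_word_def)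
  qed
  have canon_le: "canon_word C j \<in> {1..N}" if "j \<in> {1..n}" for j
  proof -
    have "card (C \<inter> {1..<j}) \<le> card {1..<j}" by (intro card_mono) auto
    then show ?thesis using that N by (auto simp: canon_word_def)
  qed
  have canon_in: "?u \<in> fund_words n N \<gamma> \<longleftrightarrow> sub \<gamma> \<subseteq> C"
  proof
    assume u: "?u \<in> fund_words n N \<gamma>"
    show "sub \<gamma> \<subseteq> C"
    proof
      fix j assume j: "j \<in> sub \<gamma>"
      then have "1 \<le> j" "Suc j \<le> n" using sub_subset[OF \<gamma>] by auto
      moreover have "?u j < ?u (j + 1)" using u j by (auto simp: fund_words_def)
      ultimately show "j \<in> C" using canon_Suc[of j] by (cases "j \<in> C") auto
    qed
  next
    assume "sub \<gamma> \<subseteq> C"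
    moreover have "1 \<le> j \<and> Suc j \<le> n" if "j \<in> sub \<gamma>" for j
      using that sub_subset[OF \<gamma>] by auto
    ultimately show "?u \<in> fund_words n N \<gamma>"
      using canon_le canon_Suc by (fastforce simp: fund_words_def)
  qed
  have words: "xmon n w = xmon n (canon_word C) \<longleftrightarrow> w = ?u" if w: "w \<in> fund_words n N \<gamma>" for w
  proof
    assume "xmon n w = xmon n (canon_word C)"
    then have "\<And>j. j \<in> {1..n} \<Longrightarrow> w j = canon_word C j"
      using xmon_eq_imp_eq mono[OF w] canon_mono by blast
    moreover have "w \<in> extensional {1..n}" using w by (auto simp: fund_words_def PiE_def)
    ultimately show "w = ?u" by (auto simp: fun_eq_iff extensional_def)
  qed (simp add: xmon_def)
  have "finite (fund_words n N \<gamma>)"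
    by (rule finite_subset[of _ "{1..n} \<rightarrow>\<^sub>E {1..N}"])
      (auto simp: fund_words_def intro!: finite_PiE)
  have "Poly_Mapping.lookup (F_poly n N \<gamma>) (xmon n (canon_word C)) =
      (\<Sum>w\<in>fund_words n N \<gamma>. if w = ?u then 1 else 0)"
    unfolding F_poly_def prod_xvar lookup_sum lookup_single when_def
    using words by (intro sum.cong) auto
  also have "\<dots> = (if sub \<gamma> \<subseteq> C then 1 else 0)"
    using \<open>finite (fund_words n N \<gamma>)\<close> canon_in by simp
  finally show ?thesis .
qed

section \<open>Triangularity and linear independence of the F and the G\<close>

lemma unitriangular_sum_zero:
  fixes a :: "'b \<Rightarrow> 'b \<Rightarrow> 'a::comm_ring_1" and s :: "'b \<Rightarrow> 'c set"
  assumes "finite X" and inj: "inj_on s X" and fin: "\<And>x. x \<in> X \<Longrightarrow> finite (s x)"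
    and diag: "\<And>x. x \<in> X \<Longrightarrow> a x x = 1"
    and tri: "\<And>x y. x \<in> X \<Longrightarrow> y \<in> X \<Longrightarrow> \<not> s x \<subseteq> s y \<Longrightarrow> a x y = 0"
    and sum0: "\<And>y. y \<in> X \<Longrightarrow> (\<Sum>x\<in>X. d x * a x y) = 0"
  shows "y \<in> X \<Longrightarrow> d y = 0"
proof (induction "card (s y)" arbitrary: y rule: less_induct)
  case less
  \<comment> \<open>In the equation for \<open>y\<close>, a term \<open>x\<close> other than
    \<open>y\<close> either has coefficient 0 or, by injectivity of \<open>s\<close>, has
    \<open>s x\<close> properly inside \<open>s y\<close>, where the induction hypothesis gives
    \<open>d x = 0\<close>.\<close>
  have "d x * a x y = 0" if x: "x \<in> X - {y}" for x
  proof (cases "s x \<subseteq> s y")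
    case True
    then have "s x \<subset> s y" using inj x less.prems by (auto simp: inj_on_def)
    then have "card (s x) < card (s y)" using fin less.prems by (simp add: psubset_card_mono)
    then show ?thesis using less.hyps x by auto
  qed (use tri x less.prems in auto)
  then have "(\<Sum>x\<in>X. d x * a x y) = d y * a y y"
    using assms(1) less.prems by (simp add: sum.remove)
  then show ?case using sum0 diag less.prems by simp
qed

text \<open>Reading off coefficients at the canonical monomials gives a linear system whose matrix
  is the inclusion relation on the sets \<open>sub \<gamma>\<close>.\<close>

lemma F_poly_independent:
  assumes "n \<le> N" "(\<Sum>\<gamma>\<in>Comp n. xconst (d \<gamma>) * F_poly n N \<gamma>) = 0" "\<gamma> \<in> Comp n"
  shows "d \<gamma> = 0"
proof (rule unitriangular_sum_zero[where s = sub and X = "Comp n"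
      and a = "\<lambda>\<gamma> \<delta>. if sub \<gamma> \<subseteq> sub \<delta> then 1 else 0"])
  fix \<delta> assume \<delta>: "\<delta> \<in> Comp n"
  have "(\<Sum>\<gamma>\<in>Comp n. d \<gamma> * (if sub \<gamma> \<subseteq> sub \<delta> then 1 else 0)) =
      Poly_Mapping.lookup (\<Sum>\<gamma>\<in>Comp n. xconst (d \<gamma>) * F_poly n N \<gamma>) (xmon n (canon_word (sub \<delta>)))"
    unfolding lookup_sum lookup_xconst_mult
    using lookup_F_poly sub_subset[OF \<delta>] assms(1) by (intro sum.cong) auto
  then show "(\<Sum>\<gamma>\<in>Comp n. d \<gamma> * (if sub \<gamma> \<subseteq> sub \<delta> then 1 else 0)) = 0"
    by (simp add: assms(2))
qed (use assms(3) inj_on_sub in auto)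

section \<open>The expansion\<close>

lemma G_poly_eq:
  assumes "\<beta> \<in> Comp n"
  shows "G_poly n N \<beta> = (\<Sum>\<gamma>\<in>Comp n.
    xconst (if sub \<beta> \<subseteq> sub \<gamma> then gcoef tvar (sub \<beta>) (sub \<gamma>) else 0) * F_poly n N \<gamma>)"
  unfolding G_poly_def refines_def
  by (intro sum.mono_neutral_cong_left) (auto simp: G_coefficient_eq[OF assms])

text \<open>The change from G to F, which serves both existence and uniqueness of the
  expansion.\<close>

lemma sum_G_poly_eq:
  "(\<Sum>\<beta>\<in>Comp n. xconst (c \<beta>) * G_poly n N \<beta>) = (\<Sum>\<gamma>\<in>Comp n.
    xconst (\<Sum>\<beta>\<in>Comp n. c \<beta> * (if sub \<beta> \<subseteq> sub \<gamma> then gcoef tvar (sub \<beta>) (sub \<gamma>) else 0))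
      * F_poly n N \<gamma>)"
proof -
  have "(\<Sum>\<beta>\<in>Comp n. xconst (c \<beta>) * G_poly n N \<beta>) = (\<Sum>\<beta>\<in>Comp n. \<Sum>\<gamma>\<in>Comp n.
      xconst (c \<beta> * (if sub \<beta> \<subseteq> sub \<gamma> then gcoef tvar (sub \<beta>) (sub \<gamma>) else 0)) * F_poly n N \<gamma>)"
    by (intro sum.cong refl) (simp only: G_poly_eq sum_distrib_left xconst_mult mult.assoc)
  also have "\<dots> = (\<Sum>\<gamma>\<in>Comp n. \<Sum>\<beta>\<in>Comp n.
      xconst (c \<beta> * (if sub \<beta> \<subseteq> sub \<gamma> then gcoef tvar (sub \<beta>) (sub \<gamma>) else 0)) * F_poly n N \<gamma>)"
    by (rule sum.swap)
  finally show ?thesis by (simp only: xconst_sum sum_distrib_right)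
qed

text \<open>Independence of the F reduces this to the system with matrix \<open>gcoef\<close>, whose
  diagonal entries are empty products.\<close>

lemma G_poly_independent:
  assumes "n \<le> N" "(\<Sum>\<beta>\<in>Comp n. xconst (d \<beta>) * G_poly n N \<beta>) = 0" "\<beta> \<in> Comp n"
  shows "d \<beta> = 0"
proof (rule unitriangular_sum_zero[where s = sub and X = "Comp n"
      and a = "\<lambda>\<beta> \<gamma>. if sub \<beta> \<subseteq> sub \<gamma> then gcoef tvar (sub \<beta>) (sub \<gamma>) else 0"])
  show "(\<Sum>\<beta>\<in>Comp n. d \<beta> * (if sub \<beta> \<subseteq> sub \<gamma> then gcoef tvar (sub \<beta>) (sub \<gamma>) else 0)) = 0"
    if "\<gamma> \<in> Comp n" for \<gamma>
    using F_poly_independent[OF assms(1) assms(2)[unfolded sum_G_poly_eq] that] .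
qed (use assms(3) inj_on_sub in \<open>auto simp: gcoef_def\<close>)

text \<open>\<open>shift_up\<close> differs from the plain successor image only at n, which
  \<open>A\<close> does not contain.\<close>

lemma subset_shift_up_iff:
  assumes "A \<subseteq> {1..<n}"
  shows "A \<subseteq> B \<union> shift_up n B \<longleftrightarrow> A \<subseteq> B \<union> Suc ` B"
    and "A \<subseteq> sym_diff B (shift_up n B) \<longleftrightarrow> A \<subseteq> sym_diff B (Suc ` B)"
proof -
  have "a \<in> shift_up n B \<longleftrightarrow> a \<in> Suc ` B" if "a \<in> A" for a
    using that assms by (auto simp: shift_up_def)
  then show "A \<subseteq> B \<union> shift_up n B \<longleftrightarrow> A \<subseteq> B \<union> Suc ` B"
    and "A \<subseteq> sym_diff B (shift_up n B) \<longleftrightarrow> A \<subseteq> sym_diff B (Suc ` B)"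
    by blast+
qed

text \<open>The coefficient of F for \<gamma> on the G side is the sum of \<open>weight\<close> over
  the subsets of \<open>sub \<gamma>\<close>. By \<open>sum_weight\<close> this is the indicator
  that selects \<gamma> in the definition of K.\<close>

lemma K_poly_expansion:
  assumes "\<alpha> \<in> Comp' n"
  shows "G_expansion n N (K_poly n N \<alpha>)
    (\<lambda>\<beta>. if sub \<alpha> \<subseteq> sub \<beta> \<union> shift_up n (sub \<beta>) then k_coef \<alpha> \<beta> else 0)"
proof -
  let ?A = "sub \<alpha>"
  have A: "?A \<subseteq> {1..<n}" and sparse: "\<And>a. a \<in> ?A \<Longrightarrow> Suc a \<notin> ?A"
    using assms sub_subset[of \<alpha> n] by (auto simp: Comp'_def)
  have "(\<Sum>\<beta>\<in>Comp n. (if ?A \<subseteq> sub \<beta> \<union> shift_up n (sub \<beta>) then k_coef \<alpha> \<beta> else 0) *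
      (if sub \<beta> \<subseteq> sub \<gamma> then gcoef tvar (sub \<beta>) (sub \<gamma>) else 0)) =
      (if ?A \<subseteq> sym_diff (sub \<gamma>) (shift_up n (sub \<gamma>)) then 1 else 0)"
    (is "(\<Sum>\<beta>\<in>Comp n. ?f \<beta>) = _") if \<gamma>: "\<gamma> \<in> Comp n" for \<gamma>
  proof -
    let ?C = "sub \<gamma>"
    have C: "?C \<subseteq> {1..<n}" using sub_subset[OF \<gamma>] .
    have "(\<Sum>\<beta>\<in>Comp n. ?f \<beta>) =
        (\<Sum>\<beta>\<in>Comp n. if sub \<beta> \<subseteq> ?C then weight tvar ?A (sub \<beta>) ?C else 0)"
    proof (intro sum.cong refl)
      fix \<beta> assume "\<beta> \<in> Comp n"
      then have "0 \<notin> sub \<beta>" using sub_subset by fastforce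
      then show "?f \<beta> = (if sub \<beta> \<subseteq> ?C then weight tvar ?A (sub \<beta>) ?C else 0)"
        by (auto simp: subset_shift_up_iff[OF A] weight_eq k_coef_eq)
    qed
    \<comment> \<open>From compositions to arbitrary subsets of [n-1], of which only those inside
      \<open>?C\<close> contribute.\<close>
    also have "\<dots> = (\<Sum>B\<in>Pow {1..<n}. if B \<subseteq> ?C then weight tvar ?A B ?C else 0)"
      by (rule sum.reindex_bij_betw[OF bij_betw_sub])
    also have "\<dots> = (\<Sum>B\<in>Pow ?C. weight tvar ?A B ?C)"
      using C by (intro sum.mono_neutral_cong_right) auto
    also have "\<dots> = (if ?A \<subseteq> sym_diff ?C (shift_up n ?C) then 1 else 0)"
      by (simp add: sum_weight[OF A C sparse] subset_shift_up_iff[OF A])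
    finally show ?thesis .
  qed
  then have "(\<Sum>\<beta>\<in>Comp n. xconst (if ?A \<subseteq> sub \<beta> \<union> shift_up n (sub \<beta>) then k_coef \<alpha> \<beta> else 0)
        * G_poly n N \<beta>) =
      (\<Sum>\<gamma>\<in>Comp n. xconst (if ?A \<subseteq> sym_diff (sub \<gamma>) (shift_up n (sub \<gamma>)) then 1 else 0)
        * F_poly n N \<gamma>)"
    unfolding sum_G_poly_eq by (intro sum.cong) auto
  also have "\<dots> = K_poly n N \<alpha>"
    unfolding K_poly_def by (intro sum.mono_neutral_cong_right) auto
  finally show ?thesis by (simp add: G_expansion_def)
qed

theorem theorem5p6:
  fixes n N :: nat and \<alpha> :: "nat list" and c :: "nat list \<Rightarrow> coef"
  assumes "\<alpha> \<in> Comp' n" and "n \<le> N"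
  shows "G_expansion n N (K_poly n N \<alpha>) c \<longleftrightarrow>
    (\<forall>\<beta>\<in>Comp n. c \<beta> =
       (if sub \<alpha> \<subseteq> sub \<beta> \<union> shift_up n (sub \<beta>) then k_coef \<alpha> \<beta> else 0))"
    (is "_ \<longleftrightarrow> (\<forall>\<beta>\<in>Comp n. c \<beta> = ?d \<beta>)")
proof
  have K: "K_poly n N \<alpha> = (\<Sum>\<gamma>\<in>Comp n. xconst (?d \<gamma>) * G_poly n N \<gamma>)"
    using K_poly_expansion[OF assms(1)] unfolding G_expansion_def .
  {
    assume "G_expansion n N (K_poly n N \<alpha>) c"
    then have eq: "(\<Sum>\<gamma>\<in>Comp n. xconst (c \<gamma>) * G_poly n N \<gamma>) =
        (\<Sum>\<gamma>\<in>Comp n. xconst (?d \<gamma>) * G_poly n N \<gamma>)"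
      unfolding G_expansion_def K[symmetric] by simp
    \<comment> \<open>Subtracting the two expansions gives a vanishing combination of the G, to
      which independence applies.\<close>
    have "xconst (c \<gamma> - ?d \<gamma>) * G_poly n N \<gamma> =
        xconst (c \<gamma>) * G_poly n N \<gamma> - xconst (?d \<gamma>) * G_poly n N \<gamma>" for \<gamma>
      by (simp only: xconst_def single_diff left_diff_distrib)
    then have "(\<Sum>\<gamma>\<in>Comp n. xconst (c \<gamma> - ?d \<gamma>) * G_poly n N \<gamma>) = 0"
      by (simp only: sum_subtractf eq diff_self)
    then show "\<forall>\<beta>\<in>Comp n. c \<beta> = ?d \<beta>"
      using G_poly_independent[OF assms(2), of "\<lambda>\<gamma>. c \<gamma> - ?d \<gamma>"] by auto
  }
  assume "\<forall>\<beta>\<in>Comp n. c \<beta> = ?d \<beta>"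
  then show "G_expansion n N (K_poly n N \<alpha>) c"
    unfolding G_expansion_def K by (intro sum.cong) auto
qed

end
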